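(* Let $T$ be a lower bound tree for the radio number (i.e. $T \in \mathcal{T}_{lb}$) of order $n_0$ and diameter $d_0$ with exactly one weight center $w_0$, and let $k \geq 3$ be an integer. Let $S_k$ be the $k$-star, i.e. the tree consisting of $k$ leaves and another vertex joined to all the leaves by edges. Let $T_{S_k}$ be the tree obtained from $S_k$ by taking $k$ disjoint copies of $T$, one for each leaf of $S_k$, and identifying the weight center $w_0$ of each copy with the corresponding leaf. Let $d = \mathrm{diam}(T_{S_k})$. Then $T_{S_k} \in \mathcal{T}_{lb}$ and $$\mathrm{rn}(T_{S_k}) = k\bigl(\mathrm{rn}(T) + n_0(d - d_0 - 2) + d_0\bigr) + 1.$$
   Context: All graphs are finite, simple and connected. $d_G(u,v)$ denotes graph distance and $\mathrm{diam}(G)$ the diameter. A radio labeling of a graph $G$ is a map $f : V(G) \to \{0,1,2,\ldots\}$ such that $|f(u)-f(v)| \geq \mathrm{diam}(G) + 1 - d_G(u,v)$ for every pair of distinct vertices $u,v$. Its span is $\max\{f(v) : v \in V(G)\}$. The radio number $\mathrm{rn}(G)$ is the minimum span over all radio labelings of $G$. For a tree $T$ and $v \in V(T)$, put $w_T(v) = \sum_{u \in V(T)} d_T(u,v)$. A weight center of $T$ is a vertex minimizing $w_T$; $W(T)$ denotes the set of weight centers, and it consists of either one vertex or two adjacent vertices. Put $\varepsilon(T) = 1$ if $|W(T)| = 1$ and $\varepsilon(T) = 0$ if $|W(T)| = 2$. The level of $u \in V(T)$ is $L_T(u) = \min\{d_T(u,x) : x \in W(T)\}$ and the total level of $T$ is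 $L(T) = \sum_{u \in V(T)} L_T(u)$. For a tree $T$ of order $n$ and diameter $d \geq 2$, define $lb(T) = (n-1)(d + \varepsilon(T)) - 2L(T) + \varepsilon(T)$ (this is a known lower bound for $\mathrm{rn}(T)$). $T$ is called a lower bound tree if $\mathrm{rn}(T) = lb(T)$; $\mathcal{T}_{lb}$ denotes the set of all lower bound trees (of diameter at least 2). *)

theory Defs
  imports "Graph_Theory.Graph_Theory"
begin

text \<open>
  A finite simple undirected graph is a \<^const>\<open>pair_graph\<close>: finite, loop-free and with a symmetric
  arc relation, each edge being the two opposite arcs.
\<close>

text \<open>
  The constant \<^const>\<open>tree\<close> is not usable here: every edge \<open>{u, v}\<close> of a symmetric digraph gives the
  closed walk \<open>u, v, u\<close>, which \<^const>\<open>pre_digraph.cycle\<close> accepts. The cycles of a simple graph are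
  those of length at least 3.
\<close>

definition simple_tree :: "'a pair_pre_digraph \<Rightarrow> bool" where
  "simple_tree G \<longleftrightarrow> pair_graph G \<and> connected (with_proj G) \<and>
     \<not> (\<exists>c. pre_digraph.cycle (with_proj G) c \<and> 3 \<le> length c)"

text \<open>In a disconnected graph the value for unreachable pairs is unspecified; all graphs below are
  connected.\<close>

definition gdist :: "'a pair_pre_digraph \<Rightarrow> 'a \<Rightarrow> 'a \<Rightarrow> nat" where
  "gdist G u v = (LEAST n. \<exists>p. pre_digraph.apath (with_proj G) u p v \<and> length p = n)"

definition gdiam :: "'a pair_pre_digraph \<Rightarrow> nat" where
  "gdiam G = Max {gdist G u v | u v. u \<in> pverts G \<and> v \<in> pverts G}"

definition radio_labeling :: "'a pair_pre_digraph \<Rightarrow> ('a \<Rightarrow> nat) \<Rightarrow> bool" where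
  "radio_labeling G f \<longleftrightarrow> (\<forall>u\<in>pverts G. \<forall>v\<in>pverts G. u \<noteq> v \<longrightarrow>
     \<bar>int (f u) - int (f v)\<bar> \<ge> int (gdiam G) + 1 - int (gdist G u v))"

definition radio_span :: "'a pair_pre_digraph \<Rightarrow> ('a \<Rightarrow> nat) \<Rightarrow> nat" where
  "radio_span G f = Max (f ` pverts G)"

definition rn :: "'a pair_pre_digraph \<Rightarrow> nat" where
  "rn G = (LEAST s. \<exists>f. radio_labeling G f \<and> radio_span G f = s)"

definition weight :: "'a pair_pre_digraph \<Rightarrow> 'a \<Rightarrow> nat" where
  "weight T v = (\<Sum>u\<in>pverts T. gdist T u v)"

definition weight_centers :: "'a pair_pre_digraph \<Rightarrow> 'a set" where
  "weight_centers T = {v \<in> pverts T. \<forall>u\<in>pverts T. weight T v \<le> weight T u}"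

text \<open>A tree has one or two weight centers, so the second branch is the case of two.\<close>

definition tree_eps :: "'a pair_pre_digraph \<Rightarrow> nat" where
  "tree_eps T = (if card (weight_centers T) = 1 then 1 else 0)"

definition level :: "'a pair_pre_digraph \<Rightarrow> 'a \<Rightarrow> nat" where
  "level T u = Min {gdist T u x | x. x \<in> weight_centers T}"

definition total_level :: "'a pair_pre_digraph \<Rightarrow> nat" where
  "total_level T = (\<Sum>u\<in>pverts T. level T u)"

definition lb :: "'a pair_pre_digraph \<Rightarrow> int" where
  "lb T = (int (card (pverts T)) - 1) * (int (gdiam T) + int (tree_eps T))
     - 2 * int (total_level T) + int (tree_eps T)"

definition lower_bound_trees :: "'a pair_pre_digraph set" where
  "lower_bound_trees = {T. simple_tree T \<and> 2 \<le> gdiam T \<and> int (rn T) = lb T}"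

definition star :: "nat \<Rightarrow> nat pair_pre_digraph" where
  "star k = \<lparr> pverts = {0..k}, parcs = {0} \<times> {1..k} \<union> {1..k} \<times> {0} \<rparr>"

definition leaves :: "'a pair_pre_digraph \<Rightarrow> 'a set" where
  "leaves S = {v \<in> pverts S. out_degree (with_proj S) v = 1}"

lemma leaves_star: "2 \<le> k \<Longrightarrow> leaves (star k) = {1..k}"
proof -
  assume k: "2 \<le> k"
  have a: "out_arcs (with_proj (star k)) 0 = Pair 0 ` {1..k}"
    by (auto simp: star_def out_arcs_def)
  have c: "out_degree (with_proj (star k)) 0 = k"
    unfolding out_degree_def a by (subst card_image) (auto simp: inj_on_def)
  have b: "out_degree (with_proj (star k)) v = 1" if "v \<in> {1..k}" for v
  proof -
    have "out_arcs (with_proj (star k)) v = {(v, 0)}"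
      using that by (auto simp: star_def out_arcs_def)
    then show ?thesis by (simp add: out_degree_def)
  qed
  have "pverts (star k) = insert 0 {1..k}"
    by (auto simp: star_def)
  with b c k show ?thesis by (auto simp: leaves_def)
qed

text \<open>
  The tree \<open>T\<^sub>S\<close>: one copy of \<open>T\<close> for each leaf of \<open>S\<close>, with the vertex \<open>w\<close> of that copy
  identified with the leaf. Vertex \<open>v\<close> of the copy at leaf \<open>l\<close> is \<open>Inr (l, v)\<close>; non-leaves of \<open>S\<close>
  are tagged with \<open>Inl\<close>. The identification is realised by letting \<open>Inr (l, w)\<close> itself play the role
  of the leaf \<open>l\<close>, which is what \<open>attach_vertex\<close> does.
\<close>

definition attach_vertex :: "'b pair_pre_digraph \<Rightarrow> 'a \<Rightarrow> 'b \<Rightarrow> 'b + 'b \<times> 'a" where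
  "attach_vertex S w x = (if x \<in> leaves S then Inr (x, w) else Inl x)"

definition leaf_attach ::
    "'a pair_pre_digraph \<Rightarrow> 'a \<Rightarrow> 'b pair_pre_digraph \<Rightarrow> ('b + 'b \<times> 'a) pair_pre_digraph" where
  "leaf_attach T w S = \<lparr>
     pverts = attach_vertex S w ` pverts S \<union> {Inr (l, v) | l v. l \<in> leaves S \<and> v \<in> pverts T},
     parcs = {(attach_vertex S w x, attach_vertex S w y) | x y. (x, y) \<in> parcs S} \<union>
             {(Inr (l, u), Inr (l, v)) | l u v. l \<in> leaves S \<and> (u, v) \<in> parcs T} \<rparr>"

end

theory Submission
  imports Defs
begin

text \<open>
  Ordering the vertices by label and bounding each gap through \<open>d(x, y) \<le> L(x) + L(y)\<close> gives the
  lower bound \<open>lb\<close>; for an optimal labeling of \<open>T\<close> equality forces the extreme labels onto the weight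
  center and a neighbour of it. In \<open>T_S\<close>, whose unique weight center is that of the star, the vertices
  are labelled in the order of such a labeling of \<open>T\<close>, all \<open>k\<close> copies of one vertex before the next.
  Any two vertices in different copies are joined through the center, so consecutive gaps are as
  small as the bound allows; for \<open>k \<ge> 3\<close> enough other vertices lie between two vertices of the same
  copy for the radio condition of \<open>T\<close> to carry over.
\<close>

section \<open>Telescoping lower bound for the range of a labeling\<close>

text \<open>Induction removes a vertex \<open>v\<close> of largest label; the last gap then runs
  from the previous largest vertex \<open>v'\<close> to \<open>v\<close>. Summing consecutive gaps
  counts each level twice except at the two ends, whence \<open>L u + L v\<close>. Distinct ends are
  recorded for the later use of \<open>gdist_sum_pos\<close>.\<close>

lemma gap_sum:
  fixes f L :: "'a \<Rightarrow> int"
  assumes "finite A" "A \<noteq> {}"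
    and gap: "\<And>x y. x \<in> A \<Longrightarrow> y \<in> A \<Longrightarrow> x \<noteq> y \<Longrightarrow> f x \<le> f y \<Longrightarrow> B - L x - L y \<le> f y - f x"
  shows "\<exists>u\<in>A. \<exists>v\<in>A. (\<forall>x\<in>A. f u \<le> f x \<and> f x \<le> f v) \<and> (2 \<le> card A \<longrightarrow> u \<noteq> v) \<and>
    (int (card A) - 1) * B - 2 * (\<Sum>x\<in>A. L x) + L u + L v \<le> f v - f u"
  using assms
proof (induction A rule: finite_psubset_induct)
  case (psubset A)
  have "Max (f ` A) \<in> f ` A"
    using psubset by simp
  then obtain v where v: "v \<in> A" "f v = Max (f ` A)"
    by auto
  then have max: "f x \<le> f v" if "x \<in> A" for x
    using that psubset by simp
  show ?case
  proof (cases "A - {v} = {}")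
    case True
    then have "A = {v}"
      using v by auto
    then show ?thesis
      by auto
  next
    case False
    have "\<exists>u\<in>A - {v}. \<exists>v'\<in>A - {v}. (\<forall>x\<in>A - {v}. f u \<le> f x \<and> f x \<le> f v') \<and>
        (2 \<le> card (A - {v}) \<longrightarrow> u \<noteq> v') \<and>
        (int (card (A - {v})) - 1) * B - 2 * (\<Sum>x\<in>A - {v}. L x) + L u + L v' \<le> f v' - f u"
      using psubset.prems v False by (intro psubset.IH) auto
    then obtain u v' where u: "u \<in> A - {v}" "v' \<in> A - {v}" "\<forall>x\<in>A - {v}. f u \<le> f x"
      and le: "(int (card (A - {v})) - 1) * B - 2 * (\<Sum>x\<in>A - {v}. L x) + L u + L v' \<le> f v' - f u"
      by blast
    have "B - L v' - L v \<le> f v - f v'"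
      using u v max by (intro psubset.prems) auto
    moreover have "(\<Sum>x\<in>A. L x) = L v + (\<Sum>x\<in>A - {v}. L x)"
      using psubset v by (simp add: sum.remove)
    moreover have "int (card A) = int (card (A - {v})) + 1"
      using card.remove[OF psubset.hyps(1) v(1)] by linarith
    ultimately have "(int (card A) - 1) * B - 2 * (\<Sum>x\<in>A. L x) + L u + L v \<le> f v - f u"
      using le by (simp add: algebra_simps)
    moreover have "\<forall>x\<in>A. f u \<le> f x \<and> f x \<le> f v"
      using u max by auto
    ultimately show ?thesis
      using u v by blast
  qed
qed

lemma radio_labelingD:
  assumes "radio_labeling G f" "u \<in> pverts G" "v \<in> pverts G" "u \<noteq> v"
  shows "int (gdiam G) + 1 - int (gdist G u v) \<le> \<bar>int (f u) - int (f v)\<bar>"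
  using assms unfolding radio_labeling_def by simp

section \<open>Distances in connected graphs\<close>

text \<open>\<open>gdist\<close> minimizes over paths only; a shortest walk is itself a path, since
  cutting out a closed subwalk would shorten it.\<close>

lemma (in pair_wf_digraph) gdist_le_awalk:
  assumes "awalk u p v"
  shows "gdist G u v \<le> length p"
proof -
  define q where "q = arg_min length (\<lambda>q. awalk u q v)"
  have q: "awalk u q v" and min: "\<And>r. awalk u r v \<Longrightarrow> length q \<le> length r"
    using arg_min_nat_lemma[of "\<lambda>q. awalk u q v" p length] assms unfolding q_def by auto
  have "distinct (awalk_verts u q)"
  proof (rule ccontr)
    assume "\<not> ?thesis"
    then obtain a r s w where "q = a @ r @ s" "0 < length r" "awalk u a w" "awalk w s v"
      using awalk_not_distinct_decomp[OF q] by force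
    then show False
      using min[of "a @ s"] by auto
  qed
  then have "apath u q v"
    using q by (simp add: apath_def)
  then have "gdist G u v \<le> length q"
    unfolding gdist_def by (intro Least_le) auto
  then show ?thesis
    using min[OF assms] by simp
qed

lemma (in pair_wf_digraph) obtain_gdist_awalk:
  assumes "awalk u p v"
  obtains q where "awalk u q v" "length q = gdist G u v"
proof -
  have "\<exists>n q. apath u q v \<and> length q = n"
    using apath_awalk_to_apath[OF assms] by blast
  then have "\<exists>q. apath u q v \<and> length q = gdist G u v"
    unfolding gdist_def by (rule LeastI_ex)
  then show ?thesis
    using that by (auto simp: apath_def)
qed

lemma (in pair_wf_digraph) awalk_snd_last:
  assumes "awalk u p v" "p \<noteq> []"
  shows "snd (last p) = v"
  using assms by (cases p rule: rev_cases) (auto simp: awalk_simps)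

text \<open>Distinctness of the arc targets does not depend on where the cycle starts, which suits
  the rotation in \<open>acyclic_S\<close>.\<close>

lemma (in pair_wf_digraph) cycle_iff:
  "cycle p \<longleftrightarrow> (\<exists>u. awalk u p u \<and> distinct (map snd p) \<and> p \<noteq> [])"
proof -
  have "tl (awalk_verts u p) = map snd p" if "awalk u p u" "p \<noteq> []" for u
    using that by (subst awalk_verts_conv'[of u p u]) auto
  then show ?thesis
    unfolding cycle_def by metis
qed

text \<open>A certificate for distances: \<open>step\<close> bounds the length of every walk from
  below, and following \<open>desc\<close> down to \<open>z\<close> builds a walk of length
  \<open>h y\<close>. Distances in the composite tree are obtained by proposing a formula and
  checking it on arcs.\<close>

lemma (in pair_wf_digraph) gdist_eqI:
  fixes h :: "'a \<Rightarrow> nat"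
  assumes "z \<in> pverts G" "h z = 0"
    and step: "\<And>x y. (x, y) \<in> parcs G \<Longrightarrow> h y \<le> h x + 1"
    and desc: "\<And>y. y \<in> pverts G \<Longrightarrow> y \<noteq> z \<Longrightarrow> \<exists>x. (x, y) \<in> parcs G \<and> h y = h x + 1"
    and "y \<in> pverts G"
  shows "gdist G z y = h y" and "\<exists>p. awalk z p y"
proof -
  have ex: "\<exists>p. awalk z p y \<and> length p = h y"
    using \<open>y \<in> pverts G\<close>
  proof (induction "h y" arbitrary: y)
    case 0
    then have "y = z"
      using desc by force
    then show ?case
      using assms by (intro exI[of _ "[]"]) (simp add: awalk_Nil_iff)
  next
    case (Suc n)
    then have "y \<noteq> z"
      using assms by auto
    then obtain x where x: "(x, y) \<in> parcs G" "h y = h x + 1"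
      using desc Suc by blast
    then obtain p where "awalk z p x" "length p = h x"
      using Suc.hyps(1)[of x] Suc.hyps(2) in_arcsD1[OF x(1)] by auto
    moreover have "awalk x [(x, y)] y"
      using x by (auto simp: awalk_simps intro: in_arcsD1 in_arcsD2)
    ultimately show ?case
      using x by (intro exI[of _ "p @ [(x, y)]"]) auto
  qed
  then show "\<exists>p. awalk z p y"
    by blast
  have le: "h v \<le> h u + length p" if "awalk u p v" for u p v
    using that
  proof (induction p arbitrary: u)
    case Nil
    then show ?case
      by (auto simp: awalk_Nil_iff)
  next
    case (Cons e p)
    then have "h v \<le> h (snd e) + length p" "(u, snd e) \<in> parcs G"
      by (cases e; auto simp: awalk_simps)+
    then show ?case
      using step[of u "snd e"] by simp
  qed
  obtain p where p: "awalk z p y" "length p = h y"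
    using ex by blast
  obtain q where "awalk z q y" "length q = gdist G z y"
    using p obtain_gdist_awalk by blast
  then show "gdist G z y = h y"
    using le[of z q y] gdist_le_awalk[OF p(1)] p assms by simp
qed

locale connected_graph = pair_graph +
  assumes con: "connected (with_proj G)"
begin

lemma nonempty: "pverts G \<noteq> {}"
  using con by (auto simp: connected_conv)

lemma gdist_awalkE:
  assumes "u \<in> pverts G" "v \<in> pverts G"
  obtains p where "awalk u p v" "length p = gdist G u v"
proof -
  have "strongly_connected (with_proj G)"
    using con sym_arcs by (intro symmetric_connected_imp_strongly_connected) auto
  then have "u \<rightarrow>\<^sup>*\<^bsub>with_proj G\<^esub> v"
    using assms by (auto simp: strongly_connected_def)
  then show ?thesis
    using that obtain_gdist_awalk by (metis reachable_awalk)
qed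

lemma gdist_self [simp]:
  assumes "u \<in> pverts G"
  shows "gdist G u u = 0"
  using gdist_le_awalk[of u "[]" u] assms by (simp add: awalk_Nil_iff)

lemma gdist_eq_0:
  assumes "u \<in> pverts G" "v \<in> pverts G" "gdist G u v = 0"
  shows "u = v"
  using assms gdist_awalkE[of u v] by (auto simp: awalk_Nil_iff)

lemma gdist_triangle:
  assumes "u \<in> pverts G" "v \<in> pverts G" "x \<in> pverts G"
  shows "gdist G u v \<le> gdist G u x + gdist G x v"
proof -
  obtain p q where "awalk u p x" "length p = gdist G u x" "awalk x q v" "length q = gdist G x v"
    using assms by (meson gdist_awalkE)
  then show ?thesis
    using gdist_le_awalk[of u "p @ q" v] by auto
qed

lemma gdist_sym:
  assumes "u \<in> pverts G" "v \<in> pverts G"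
  shows "gdist G u v = gdist G v u"
proof -
  have "gdist G v u \<le> gdist G u v" if uv: "u \<in> pverts G" "v \<in> pverts G" for u v
  proof -
    obtain p where "awalk u p v" "length p = gdist G u v"
      using uv by (rule gdist_awalkE)
    moreover have "length (rev_path p) = length p"
      by (induction p) auto
    ultimately show ?thesis
      using gdist_le_awalk[of v "rev_path p" u] by simp
  qed
  then show ?thesis
    using assms by (simp add: order_antisym)
qed

lemma gdist_arc_le:
  assumes "u \<in> pverts G" "(x, y) \<in> parcs G"
  shows "gdist G u y \<le> Suc (gdist G u x)"
proof -
  have "awalk x [(x, y)] y"
    using assms by (auto simp: awalk_simps intro: in_arcsD1 in_arcsD2)
  then have "gdist G x y \<le> 1"
    using gdist_le_awalk[of x "[(x, y)]" y] by simp
  moreover have "gdist G u y \<le> gdist G u x + gdist G x y"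
    using assms in_arcsD1 in_arcsD2 by (intro gdist_triangle) auto
  ultimately show ?thesis
    by linarith
qed

lemma gdist_predecessor:
  assumes "u \<in> pverts G" "y \<in> pverts G" "y \<noteq> u"
  shows "\<exists>x. (x, y) \<in> parcs G \<and> gdist G u y = gdist G u x + 1"
proof -
  obtain p where p: "awalk u p y" "length p = gdist G u y"
    using assms gdist_awalkE by metis
  then have "p \<noteq> []"
    using assms by (auto simp: awalk_Nil_iff)
  then obtain q x y' where "p = q @ [(x, y')]"
    by (metis append_butlast_last_id surj_pair)
  then have q: "awalk u q x" "(x, y) \<in> parcs G" "Suc (length q) = gdist G u y"
    using p by (auto simp: awalk_simps)
  then have "gdist G u x \<le> length q"
    using gdist_le_awalk by blast
  then show ?thesis
    using q gdist_arc_le[OF assms(1), of x y] by (intro exI[of _ x]) auto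
qed

lemma finite_gdists: "finite {gdist G u v | u v. u \<in> pverts G \<and> v \<in> pverts G}"
proof -
  have "{gdist G u v | u v. u \<in> pverts G \<and> v \<in> pverts G} =
      (\<lambda>(u, v). gdist G u v) ` (pverts G \<times> pverts G)"
    by auto
  then show ?thesis
    using pair_finite_verts by simp
qed

lemma gdist_le_gdiam:
  assumes "u \<in> pverts G" "v \<in> pverts G"
  shows "gdist G u v \<le> gdiam G"
  unfolding gdiam_def using assms finite_gdists by (intro Max_ge) auto

lemma gdiam_attained:
  obtains u v where "u \<in> pverts G" "v \<in> pverts G" "gdist G u v = gdiam G"
proof -
  have "gdiam G \<in> {gdist G u v | u v. u \<in> pverts G \<and> v \<in> pverts G}"
    unfolding gdiam_def using finite_gdists nonempty by (intro Max_in) auto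
  then show ?thesis
    using that by auto
qed

lemma card_ge_2:
  assumes "1 \<le> gdiam G"
  shows "2 \<le> card (pverts G)"
proof -
  obtain u v where uv: "u \<in> pverts G" "v \<in> pverts G" "gdist G u v = gdiam G"
    by (rule gdiam_attained)
  then have "card {u, v} = 2"
    using assms by (cases "u = v") auto
  moreover have "card {u, v} \<le> card (pverts G)"
    using uv pair_finite_verts by (intro card_mono) auto
  ultimately show ?thesis
    by simp
qed

section \<open>Radio labelings and the radio number\<close>

lemma inj_on_radio_labeling:
  assumes "radio_labeling G f"
  shows "inj_on f (pverts G)"
proof (intro inj_onI, rule ccontr)
  fix u v
  assume uv: "u \<in> pverts G" "v \<in> pverts G" "f u = f v" "u \<noteq> v"
  then have "int (gdiam G) + 1 - int (gdist G u v) \<le> \<bar>int (f u) - int (f v)\<bar>"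
    using assms by (intro radio_labelingD)
  then show False
    using uv gdist_le_gdiam[of u v] by simp
qed

lemma rn_le:
  assumes "radio_labeling G f" "\<And>x. x \<in> pverts G \<Longrightarrow> f x \<le> s"
  shows "rn G \<le> s"
proof -
  have "rn G \<le> radio_span G f"
    unfolding rn_def using assms by (intro Least_le) auto
  also have "\<dots> \<le> s"
    unfolding radio_span_def using assms pair_finite_verts nonempty by simp
  finally show ?thesis .
qed

text \<open>\<open>rn\<close> is a \<open>LEAST\<close> value and needs a witness: an injective
  numbering spread by the factor \<open>gdiam G + 1\<close> satisfies every constraint.\<close>

lemma ex_radio_labeling: "\<exists>f. radio_labeling G f"
proof -
  obtain e :: "'a \<Rightarrow> nat" where e: "inj_on e (pverts G)"
    using finite_imp_inj_to_nat_seg[OF pair_finite_verts] by blast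
  have "radio_labeling G (\<lambda>u. e u * (gdiam G + 1))"
    unfolding radio_labeling_def
  proof (intro ballI impI)
    fix u v
    assume "u \<in> pverts G" "v \<in> pverts G" "u \<noteq> v"
    then have "e u \<noteq> e v"
      using e by (auto dest: inj_onD)
    then have "1 * (int (gdiam G) + 1) \<le> \<bar>int (e u) - int (e v)\<bar> * (int (gdiam G) + 1)"
      by (intro mult_right_mono) linarith+
    also have "\<dots> = \<bar>(int (e u) - int (e v)) * (int (gdiam G) + 1)\<bar>"
      by (simp add: abs_mult)
    also have "(int (e u) - int (e v)) * (int (gdiam G) + 1) =
        int (e u * (gdiam G + 1)) - int (e v * (gdiam G + 1))"
      by (simp add: algebra_simps)
    finally show "int (gdiam G) + 1 - int (gdist G u v) \<le>
        \<bar>int (e u * (gdiam G + 1)) - int (e v * (gdiam G + 1))\<bar>"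
      by simp
  qed
  then show ?thesis
    by blast
qed

lemma rn_attained:
  obtains f where "radio_labeling G f" "\<And>x. x \<in> pverts G \<Longrightarrow> f x \<le> rn G"
proof -
  have "\<exists>f. radio_labeling G f \<and> radio_span G f = rn G"
    unfolding rn_def by (rule LeastI_ex) (use ex_radio_labeling in blast)
  then obtain f where f: "radio_labeling G f" "Max (f ` pverts G) = rn G"
    by (auto simp: radio_span_def)
  then have "f x \<le> rn G" if "x \<in> pverts G" for x
    using that pair_finite_verts by (metis Max_ge finite_imageI imageI)
  then show ?thesis
    using that f(1) by blast
qed

section \<open>The bound \<open>lb\<close> for a single weight center and labelings that attain
  it\<close>

lemma lb_unique_center:
  assumes "weight_centers G = {c}"
  shows "lb G = (int (card (pverts G)) - 1) * (int (gdiam G) + 1) -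
    2 * (\<Sum>u\<in>pverts G. int (gdist G u c)) + 1"
proof -
  have "level G u = gdist G u c" for u
    by (simp add: level_def assms)
  then show ?thesis
    using assms by (simp add: lb_def tree_eps_def total_level_def)
qed

text \<open>This is \<open>gap_sum\<close> with \<open>B = gdiam G + 1\<close> and \<open>L\<close>
  the distance to \<open>c\<close>; the triangle inequality through \<open>c\<close> supplies its
  gap hypothesis. The final \<open>- 1\<close> cancels the last \<open>+ tree_eps\<close> in
  \<open>lb\<close>.\<close>

lemma radio_labeling_gap:
  assumes "weight_centers G = {c}" "radio_labeling G f" "1 \<le> gdiam G"
  obtains u v where "u \<in> pverts G" "v \<in> pverts G" "u \<noteq> v"
    "\<And>x. x \<in> pverts G \<Longrightarrow> f u \<le> f x \<and> f x \<le> f v"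
    "lb G + int (gdist G u c) + int (gdist G v c) - 1 \<le> int (f v) - int (f u)"
proof -
  have c: "c \<in> pverts G"
    using assms(1) by (auto simp: weight_centers_def)
  have "\<exists>u\<in>pverts G. \<exists>v\<in>pverts G. (\<forall>x\<in>pverts G. int (f u) \<le> int (f x) \<and> int (f x) \<le> int (f v)) \<and>
      (2 \<le> card (pverts G) \<longrightarrow> u \<noteq> v) \<and>
      (int (card (pverts G)) - 1) * (int (gdiam G) + 1) - 2 * (\<Sum>x\<in>pverts G. int (gdist G x c))
        + int (gdist G u c) + int (gdist G v c) \<le> int (f v) - int (f u)"
  proof (rule gap_sum)
    fix x y
    assume xy: "x \<in> pverts G" "y \<in> pverts G" "x \<noteq> y" "int (f x) \<le> int (f y)"
    then have "int (gdiam G) + 1 - int (gdist G x y) \<le> \<bar>int (f x) - int (f y)\<bar>"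
      using assms(2) by (intro radio_labelingD)
    then show "int (gdiam G) + 1 - int (gdist G x c) - int (gdist G y c) \<le> int (f y) - int (f x)"
      using gdist_triangle[OF xy(1,2) c] gdist_sym[OF c xy(2)] xy(4) by linarith
  qed (use pair_finite_verts nonempty in auto)
  then obtain u v where uv: "u \<in> pverts G" "v \<in> pverts G" "u \<noteq> v"
    "\<And>x. x \<in> pverts G \<Longrightarrow> int (f u) \<le> int (f x) \<and> int (f x) \<le> int (f v)"
    and gap: "(int (card (pverts G)) - 1) * (int (gdiam G) + 1) - 2 * (\<Sum>x\<in>pverts G. int (gdist G x c))
        + int (gdist G u c) + int (gdist G v c) \<le> int (f v) - int (f u)"
    using card_ge_2[OF assms(3)] by blast
  have "lb G + int (gdist G u c) + int (gdist G v c) - 1 \<le> int (f v) - int (f u)"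
    using gap lb_unique_center[OF assms(1)] by linarith
  then show ?thesis
    using that uv by simp
qed

text \<open>Only one of two distinct vertices can be the center; this makes up for the
  \<open>- 1\<close> in \<open>radio_labeling_gap\<close>.\<close>

lemma gdist_sum_pos:
  assumes "u \<in> pverts G" "v \<in> pverts G" "u \<noteq> v" "c \<in> pverts G"
  shows "1 \<le> gdist G u c + gdist G v c"
proof (rule ccontr)
  assume "\<not> ?thesis"
  then have "u = c" "v = c"
    using assms gdist_eq_0 by auto
  then show False
    using assms by simp
qed

lemma lb_le_rn:
  assumes "weight_centers G = {c}" "1 \<le> gdiam G"
  shows "lb G \<le> int (rn G)"
proof -
  have c: "c \<in> pverts G"
    using assms(1) by (auto simp: weight_centers_def)
  obtain f where f: "radio_labeling G f" "\<And>x. x \<in> pverts G \<Longrightarrow> f x \<le> rn G"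
    using rn_attained by metis
  obtain u v where uv: "u \<in> pverts G" "v \<in> pverts G" "u \<noteq> v"
    and gap: "lb G + int (gdist G u c) + int (gdist G v c) - 1 \<le> int (f v) - int (f u)"
    using radio_labeling_gap[OF assms(1) f(1) assms(2)] by metis
  have "1 \<le> gdist G u c + gdist G v c"
    by (rule gdist_sum_pos) (use uv c in auto)
  then show ?thesis
    using gap f(2)[OF uv(2)] by linarith
qed

text \<open>Widening all gaps between consecutive labels by \<open>E - gdiam G\<close> gives a radio labeling for the
  larger diameter \<open>E\<close>.\<close>

lemma stretched_labelingE:
  fixes E :: int
  assumes f: "radio_labeling G f" and E: "int (gdiam G) \<le> E"
    and u: "u \<in> pverts G" "f u = 0" and c: "c \<in> pverts G" "\<And>x. x \<in> pverts G \<Longrightarrow> f x \<le> f c"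
  obtains g :: "'a \<Rightarrow> int" where "g u = 0" "\<And>x. 0 \<le> g x" "\<And>x. x \<in> pverts G \<Longrightarrow> g x \<le> g c"
    "g c = int (f c) + (int (card (pverts G)) - 1) * (E - int (gdiam G))"
    "\<And>x y. x \<in> pverts G \<Longrightarrow> y \<in> pverts G \<Longrightarrow> x \<noteq> y \<Longrightarrow> E + 1 - int (gdist G x y) \<le> \<bar>g x - g y\<bar>"
proof -
  \<comment> \<open>\<open>r x\<close> is the rank of \<open>x\<close> in the label order, so
    passing to a larger label raises it by at least one.\<close>
  define r where "r x = card {y \<in> pverts G. f y < f x}" for x
  define g where "g x = int (f x) + int (r x) * (E - int (gdiam G))" for x
  have fin: "finite {y \<in> pverts G. f y < f x}" for x
    using pair_finite_verts by simp
  have r_mono: "r x \<le> r y" if "f x \<le> f y" for x y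
    unfolding r_def using that fin by (intro card_mono) auto
  have r_less: "r x < r y" if "x \<in> pverts G" "f x < f y" for x y
    unfolding r_def using that fin by (intro psubset_card_mono) auto
  have "{y \<in> pverts G. f y < f c} = pverts G - {c}"
    using c inj_on_radio_labeling[OF f] by (fastforce simp: less_le dest: inj_onD)
  then have "int (r c) = int (card (pverts G)) - 1"
    using card.remove[OF pair_finite_verts c(1)] by (simp add: r_def)
  then have g_c: "g c = int (f c) + (int (card (pverts G)) - 1) * (E - int (gdiam G))"
    by (simp add: g_def)
  have g_u: "g u = 0"
    using u by (simp add: g_def r_def)
  have nonneg: "0 \<le> g x" for x
    using E by (simp add: g_def)
  have le: "g x \<le> g c" if "x \<in> pverts G" for x
  proof -
    have "int (r x) * (E - int (gdiam G)) \<le> int (r c) * (E - int (gdiam G))"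
      using E r_mono c that by (intro mult_right_mono) auto
    then show ?thesis
      using c(2)[OF that] by (simp add: g_def)
  qed
  have less: "E + 1 - int (gdist G x y) \<le> g y - g x"
    if xy: "x \<in> pverts G" "y \<in> pverts G" "f x < f y" for x y
  proof -
    have "int (gdiam G) + 1 - int (gdist G x y) \<le> \<bar>int (f x) - int (f y)\<bar>"
      using f xy by (intro radio_labelingD) auto
    moreover have "1 * (E - int (gdiam G)) \<le> (int (r y) - int (r x)) * (E - int (gdiam G))"
      using r_less[OF xy(1,3)] E by (intro mult_right_mono) auto
    ultimately show ?thesis
      using xy(3) by (simp add: g_def left_diff_distrib)
  qed
  have gap: "E + 1 - int (gdist G x y) \<le> \<bar>g x - g y\<bar>"
    if xy: "x \<in> pverts G" "y \<in> pverts G" "x \<noteq> y" for x y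
  proof -
    have "f x \<noteq> f y"
      using xy inj_on_radio_labeling[OF f] by (auto dest: inj_onD)
    then consider "f x < f y" | "f y < f x"
      by linarith
    then show ?thesis
      using less[of x y] less[of y x] xy gdist_sym[of x y] by cases auto
  qed
  show ?thesis
    using that[OF g_u nonneg le g_c gap] by blast
qed

text \<open>The extreme labels lie on the center and a neighbour of it; reversing the labeling if needed, the
  center gets the largest one.\<close>

lemma optimal_labelingE:
  assumes c: "weight_centers G = {c}" and opt: "int (rn G) = lb G" and "1 \<le> gdiam G"
  obtains f u where "radio_labeling G f" "u \<in> pverts G" "f u = 0" "gdist G u c = 1" "f c = rn G"
    "\<And>x. x \<in> pverts G \<Longrightarrow> f x \<le> rn G"
proof -
  have cV: "c \<in> pverts G"
    using c by (auto simp: weight_centers_def)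
  obtain f where f: "radio_labeling G f" and le: "\<And>x. x \<in> pverts G \<Longrightarrow> f x \<le> rn G"
    using rn_attained by metis
  obtain u v where uv: "u \<in> pverts G" "v \<in> pverts G" "u \<noteq> v"
    and gap: "lb G + int (gdist G u c) + int (gdist G v c) - 1 \<le> int (f v) - int (f u)"
    using radio_labeling_gap[OF c f(1) assms(3)] by metis
  have "1 \<le> gdist G u c + gdist G v c"
    by (rule gdist_sum_pos) (use uv cV in auto)
  \<comment> \<open>Since \<open>f v\<close> is at most \<open>rn G = lb G\<close>, every inequality
    is tight.\<close>
  then have ends: "gdist G u c + gdist G v c = 1" "f u = 0" "f v = rn G"
    using gap opt le[OF uv(2)] by linarith+
  show ?thesis
  proof (cases "gdist G v c = 0")
    case True
    then have "v = c"
      using uv cV gdist_eq_0 by blast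
    then show ?thesis
      using that[of f u] f le uv ends True by simp
  next
    case False
    then have uc: "u = c" "gdist G v c = 1"
      using ends uv cV gdist_eq_0 by auto
    \<comment> \<open>Here the center carries label 0; reflecting the labels exchanges the two ends
      and preserves all label differences.\<close>
    have "radio_labeling G (\<lambda>x. rn G - f x)"
      using f le unfolding radio_labeling_def by (auto simp: of_nat_diff abs_minus_commute)
    then show ?thesis
      using that[of "\<lambda>x. rn G - f x" v] le uv ends uc by simp
  qed
qed

end

section \<open>Attaching copies of a tree to a star\<close>

locale star_attachment = T: connected_graph T for T :: "'a pair_pre_digraph" +
  fixes w :: 'a and k :: nat
  assumes w: "w \<in> pverts T" and k: "2 \<le> k"
begin

abbreviation S :: "(nat + nat \<times> 'a) pair_pre_digraph" where
  "S \<equiv> leaf_attach T w (star k)"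

abbreviation L :: "'a \<Rightarrow> nat" where
  "L u \<equiv> gdist T u w"

lemma attach_vertex_star:
  "attach_vertex (star k) w x = (if x \<in> {1..k} then Inr (x, w) else Inl x)"
  using k by (simp add: attach_vertex_def leaves_star)

lemma pverts_S: "pverts S = insert (Inl 0) (Inr ` ({1..k} \<times> pverts T))"
proof -
  have "attach_vertex (star k) w ` pverts (star k) = insert (Inl 0) (Inr ` ({1..k} \<times> {w}))"
  proof -
    have "pverts (star k) = insert 0 {1..k}"
      by (auto simp: star_def)
    then show ?thesis
      by (auto simp: attach_vertex_star image_iff)
  qed
  then show ?thesis
    using w k by (auto simp: leaf_attach_def leaves_star)
qed

lemma parcs_S:
  "parcs S = (\<lambda>a. (Inl 0, Inr (a, w))) ` {1..k} \<union> (\<lambda>a. (Inr (a, w), Inl 0)) ` {1..k} \<union>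
    {(Inr (a, u), Inr (a, v)) | a u v. a \<in> {1..k} \<and> (u, v) \<in> parcs T}"
proof -
  let ?f = "attach_vertex (star k) w"
  have star: "parcs (star k) = (\<lambda>a. (0, a)) ` {1..k} \<union> (\<lambda>a. (a, 0)) ` {1..k}"
    by (auto simp: star_def)
  have "{(?f x, ?f y) | x y. (x, y) \<in> parcs (star k)} = (\<lambda>(x, y). (?f x, ?f y)) ` parcs (star k)"
    by auto
  also have "\<dots> = (\<lambda>a. (Inl 0, Inr (a, w))) ` {1..k} \<union> (\<lambda>a. (Inr (a, w), Inl 0)) ` {1..k}"
    unfolding star by (simp add: image_Un image_image attach_vertex_star cong: image_cong_simp)
  finally show ?thesis
    using k by (simp add: leaf_attach_def leaves_star)
qed

lemma vertex_cases [consumes 1, case_names center copy]: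
  assumes "x \<in> pverts S"
  obtains "x = Inl 0" | a u where "x = Inr (a, u)" "a \<in> {1..k}" "u \<in> pverts T"
  using assms by (auto simp: pverts_S)

lemma arc_cases [consumes 1, case_names out into copy]:
  assumes "(x, y) \<in> parcs S"
  obtains a where "x = Inl 0" "y = Inr (a, w)" "a \<in> {1..k}"
  | a where "x = Inr (a, w)" "y = Inl 0" "a \<in> {1..k}"
  | a u v where "x = Inr (a, u)" "y = Inr (a, v)" "a \<in> {1..k}" "(u, v) \<in> parcs T"
  using assms by (auto simp: parcs_S)

lemma pair_graph_S: "pair_graph S"
proof
  fix e
  assume "e \<in> parcs S"
  then have e: "(fst e, snd e) \<in> parcs S"
    by simp
  show "fst e \<in> pverts S"
    using e by (cases rule: arc_cases) (auto simp: pverts_S w dest: T.in_arcsD1)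
  show "snd e \<in> pverts S"
    using e by (cases rule: arc_cases) (auto simp: pverts_S w dest: T.in_arcsD2)
  show "fst e \<noteq> snd e"
    using e by (cases rule: arc_cases) (auto dest: T.no_loops')
next
  have "{(Inr (a, u) :: nat + nat \<times> 'a, Inr (a, v) :: nat + nat \<times> 'a) | a u v.
      a \<in> {1..k} \<and> (u, v) \<in> parcs T} =
    (\<lambda>(a, u, v). (Inr (a, u), Inr (a, v))) ` ({1..k} \<times> parcs T)"
    by force
  then show "finite (parcs S)"
    using T.pair_finite_arcs by (simp add: parcs_S)
  show "finite (pverts S)"
    using T.pair_finite_verts by (simp add: pverts_S)
  have "(y, x) \<in> parcs S" if "(x, y) \<in> parcs S" for x y
    using that by (cases rule: arc_cases) (auto simp: parcs_S intro: T.arcs_symmetric)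
  then show "symmetric (with_proj S)"
    by (simp add: symmetric_def sym_def)
qed

sublocale S: pair_graph S
  by (rule pair_graph_S)

section \<open>Distances in the attached tree and its connectedness\<close>

fun center_dist :: "nat + nat \<times> 'a \<Rightarrow> nat" where
  "center_dist (Inl _) = 0"
| "center_dist (Inr (_, v)) = L v + 1"

text \<open>Like \<open>center_dist\<close>, a candidate for \<open>gdist_eqI\<close>. A route
  between different copies passes through both copies of \<open>w\<close> and the center, hence the
  two star edges in \<open>+ 2\<close>.\<close>

fun copy_dist :: "nat \<Rightarrow> 'a \<Rightarrow> nat + nat \<times> 'a \<Rightarrow> nat" where
  "copy_dist a u (Inl _) = L u + 1"
| "copy_dist a u (Inr (b, v)) = (if a = b then gdist T u v else L u + L v + 2)"

lemma L_arc:
  assumes "(u, v) \<in> parcs T"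
  shows "L v \<le> Suc (L u)"
  using T.gdist_arc_le[OF w assms] T.gdist_sym w T.in_arcsD1[OF assms] T.in_arcsD2[OF assms]
  by simp

lemma L_predecessor:
  assumes "v \<in> pverts T" "v \<noteq> w"
  obtains u where "(u, v) \<in> parcs T" "L v = L u + 1"
  using T.gdist_predecessor[OF w assms] T.gdist_sym w assms T.in_arcsD1 by metis

lemma
  assumes "y \<in> pverts S"
  shows gdist_center: "gdist S (Inl 0) y = center_dist y"
    and awalk_center: "\<exists>p. S.awalk (Inl 0) p y"
proof -
  have step: "center_dist y \<le> center_dist x + 1" if "(x, y) \<in> parcs S" for x y
    using that by (cases rule: arc_cases) (auto simp: w L_arc)
  have desc: "\<exists>x. (x, y) \<in> parcs S \<and> center_dist y = center_dist x + 1"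
    if y: "y \<in> pverts S" "y \<noteq> Inl 0" for y
    using y(1)
  proof (cases rule: vertex_cases)
    case (copy b v)
    show ?thesis
    proof (cases "v = w")
      case True
      then show ?thesis
        using copy w by (intro exI[of _ "Inl 0"]) (auto simp: parcs_S)
    next
      case False
      then obtain u where "(u, v) \<in> parcs T" "L v = L u + 1"
        using copy L_predecessor by metis
      then show ?thesis
        using copy by (intro exI[of _ "Inr (b, u)"]) (auto simp: parcs_S)
    qed
  qed (use y in simp)
  have c: "Inl 0 \<in> pverts S"
    by (simp add: pverts_S)
  show "gdist S (Inl 0) y = center_dist y"
    by (rule S.gdist_eqI(1)[OF c _ step desc assms]) auto
  show "\<exists>p. S.awalk (Inl 0) p y"
    by (rule S.gdist_eqI(2)[OF c _ step desc assms]) auto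
qed

lemma gdist_copy:
  assumes "y \<in> pverts S" and a: "a \<in> {1..k}" and u: "u \<in> pverts T"
  shows "gdist S (Inr (a, u)) y = copy_dist a u y"
proof -
  have step: "copy_dist a u y \<le> copy_dist a u x + 1" if "(x, y) \<in> parcs S" for x y
    using that by (cases rule: arc_cases) (auto simp: w L_arc T.gdist_arc_le[OF u])
  have desc: "\<exists>x. (x, y) \<in> parcs S \<and> copy_dist a u y = copy_dist a u x + 1"
    if y: "y \<in> pverts S" "y \<noteq> Inr (a, u)" for y
    using y(1)
  proof (cases rule: vertex_cases)
    case center
    then show ?thesis
      using a by (intro exI[of _ "Inr (a, w)"]) (auto simp: parcs_S)
  next
    case (copy b v)
    \<comment> \<open>In a foreign copy the predecessor of \<open>w\<close> is the center; any other
      vertex is approached from the side of \<open>w\<close>.\<close>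
    consider "b = a" | "b \<noteq> a" "v = w" | "b \<noteq> a" "v \<noteq> w"
      by blast
    then show ?thesis
    proof cases
      case 1
      then obtain x where "(x, v) \<in> parcs T" "gdist T u v = gdist T u x + 1"
        using T.gdist_predecessor[OF u copy(3)] y copy by auto
      then show ?thesis
        using copy 1 by (intro exI[of _ "Inr (b, x)"]) (auto simp: parcs_S)
    next
      case 2
      then show ?thesis
        using copy w by (intro exI[of _ "Inl 0"]) (auto simp: parcs_S)
    next
      case 3
      then obtain x where "(x, v) \<in> parcs T" "L v = L x + 1"
        using copy L_predecessor by metis
      then show ?thesis
        using copy 3 by (intro exI[of _ "Inr (b, x)"]) (auto simp: parcs_S)
    qed
  qed
  have au: "Inr (a, u) \<in> pverts S"
    using a u by (simp add: pverts_S)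
  show ?thesis
    by (rule S.gdist_eqI(1)[OF au _ step desc assms(1)]) (use u in auto)
qed

lemma connected_S: "connected (with_proj S)"
proof -
  have "\<exists>p. S.awalk u p v" if uv: "u \<in> pverts S" "v \<in> pverts S" for u v
  proof -
    obtain p q where "S.awalk (Inl 0) p u" "S.awalk (Inl 0) q v"
      using awalk_center uv by blast
    then have "S.awalk u (rev_path p @ q) v"
      by auto
    then show ?thesis
      by blast
  qed
  then have "u \<rightarrow>\<^sup>*\<^bsub>with_proj S\<^esub> v" if "u \<in> pverts S" "v \<in> pverts S" for u v
    using that by (simp add: S.reachable_awalk)
  then have "(u, v) \<in> rtrancl_on (pverts S) ((parcs S)\<^sup>s)" if "u \<in> pverts S" "v \<in> pverts S" for u v
    using that by (auto simp: reachable_def symcl_def intro: rtrancl_on_mono)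
  then show ?thesis
    by (auto simp: connected_conv pverts_S)
qed

sublocale S: connected_graph S
  by unfold_locales (rule connected_S)

section \<open>Acyclicity of the attached tree\<close>

text \<open>A copy can only be left through the center, so a walk that starts in a copy and never
  enters \<open>Inl 0\<close> projects to a walk of \<open>T\<close>.\<close>

lemma copy_awalk:
  assumes "S.awalk (Inr (a, u)) p (Inr (b, v))" "Inl 0 \<notin> snd ` set p"
  shows "\<exists>q. p = map (\<lambda>(x, y). (Inr (a, x), Inr (a, y))) q \<and> T.awalk u q v \<and> b = a"
  using assms
proof (induction p arbitrary: u)
  case Nil
  then show ?case
    by (auto simp: S.awalk_Nil_iff T.awalk_Nil_iff pverts_S)
next
  case (Cons e p)
  then have e: "(Inr (a, u), snd e) \<in> parcs S" and p: "S.awalk (snd e) p (Inr (b, v))"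
    by (cases e; auto simp: S.awalk_simps)+
  from e obtain u' where u': "snd e = Inr (a, u')" "(u, u') \<in> parcs T"
    by (cases rule: arc_cases) (use Cons.prems in auto)
  then obtain q where "p = map (\<lambda>(x, y). (Inr (a, x), Inr (a, y))) q" "T.awalk u' q v" "b = a"
    using Cons.IH[of u'] p Cons.prems(2) by auto
  moreover have "e = (Inr (a, u), Inr (a, u'))"
    using Cons.prems u' by (cases e) (auto simp: S.awalk_simps)
  ultimately show ?case
    using u' by (intro exI[of _ "(u, u') # q"]) (auto simp: T.awalk_simps dest: T.in_arcsD1)
qed

text \<open>A cycle through the center, rotated to start there, enters and leaves a copy through the same
  vertex, so it has length 2; all other cycles lie in one copy.\<close>

lemma acyclic_S:
  assumes acyclic: "\<not> (\<exists>q. T.cycle q \<and> 3 \<le> length q)"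
  shows "\<not> (\<exists>p. S.cycle p \<and> 3 \<le> length p)"
proof
  assume "\<exists>p. S.cycle p \<and> 3 \<le> length p"
  then obtain p x where p: "S.awalk x p x" "distinct (map snd p)" "3 \<le> length p"
    by (auto simp: S.cycle_iff)
  show False
  proof (cases "Inl 0 \<in> snd ` set p")
    case True
    then obtain q e r where qer: "p = q @ e # r" "snd e = Inl 0"
      by (metis imageE split_list)
    \<comment> \<open>Rotate the cycle so that the arc \<open>e\<close> into the center comes last;
      the remaining arcs \<open>r @ q\<close> start at the center and do not return to it.\<close>
    have walk: "S.awalk (Inl 0) ((r @ q) @ [e]) (Inl 0)"
    proof -
      have "S.awalk x (q @ [e]) (Inl 0)" "S.awalk (Inl 0) r x"
        using p(1) qer by (auto simp: S.awalk_simps S.awalk_append_iff dest: S.in_arcsD2 S.arc_snd_in_verts)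
      then show ?thesis
        by auto
    qed
    have dist: "distinct (map snd (r @ q))" "Inl 0 \<notin> snd ` set (r @ q)"
      using p(2) qer by auto
    have "2 \<le> length (r @ q)"
      using p(3) qer by simp
    \<comment> \<open>Length at least 3 leaves a nonempty \<open>m\<close> between the arc
      \<open>e1\<close> out of the center and the arc \<open>e\<close> back; length 2 would be a
      mere back-and-forth along one edge.\<close>
    then obtain e1 m where m: "r @ q = e1 # m" "m \<noteq> []"
      by (metis Suc_le_length_iff length_0_conv nat.distinct(1) not_less_eq_eq numeral_2_eq_2 zero_le)
    have "(Inl 0, snd e1) \<in> parcs S" and tail: "S.awalk (snd e1) (m @ [e]) (Inl 0)"
      using walk unfolding m by (cases e1; auto simp: S.awalk_simps)+
    then obtain a where a: "snd e1 = Inr (a, w)"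
      by (auto elim: arc_cases)
    have "(fst e, Inl 0) \<in> parcs S" and mid: "S.awalk (snd e1) m (fst e)"
      using tail qer(2) by (cases e; auto simp: S.awalk_simps)+
    then obtain b where b: "fst e = Inr (b, w)"
      by (auto elim: arc_cases)
    have "Inl 0 \<notin> snd ` set m"
      using dist(2) unfolding m by auto
    then have "b = a"
      using copy_awalk[of a w m b w] mid a b by auto
    \<comment> \<open>\<open>m\<close> ends where \<open>e1\<close> ended, at the copy of
      \<open>w\<close>, so that vertex is an arc target twice.\<close>
    then have "snd (last m) = snd e1"
      using S.awalk_snd_last[OF mid m(2)] a b by simp
    then have "snd e1 \<in> snd ` set m"
      using m(2) by (metis image_eqI last_in_set)
    then show False
      using dist(1) unfolding m by simp
  next
    case False
    have "p \<noteq> []"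
      using p(3) by auto
    then have "x \<noteq> Inl 0"
      using False S.awalk_snd_last[OF p(1)] by (metis image_eqI last_in_set)
    moreover have "x \<in> pverts S"
      using p(1) S.awalk_hd_in_verts by blast
    ultimately obtain a u where "x = Inr (a, u)"
      by (auto simp: pverts_S)
    then obtain q where q: "p = map (\<lambda>(x, y). (Inr (a, x), Inr (a, y))) q" "T.awalk u q u"
      using copy_awalk[of a u p a u] p(1) False by blast
    have "map snd p = map (\<lambda>y. Inr (a, y)) (map snd q)"
      unfolding q by auto
    then have "distinct (map snd q)"
      using p(2) by (simp only: distinct_map)
    then have "T.cycle q" "3 \<le> length q"
      using q p(3) by (auto simp: T.cycle_iff)
    then show False
      using acyclic by blast
  qed
qed

section \<open>Weight center, order and lower bound of the attached tree\<close>

lemma sum_S: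
  fixes h :: "nat + nat \<times> 'a \<Rightarrow> 'c :: comm_monoid_add"
  shows "(\<Sum>x\<in>pverts S. h x) = h (Inl 0) + (\<Sum>a\<in>{1..k}. \<Sum>u\<in>pverts T. h (Inr (a, u)))"
proof -
  have "(\<Sum>x\<in>pverts S. h x) = h (Inl 0) + (\<Sum>x\<in>Inr ` ({1..k} \<times> pverts T). h x)"
    unfolding pverts_S using T.pair_finite_verts by (intro sum.insert) auto
  also have "(\<Sum>x\<in>Inr ` ({1..k} \<times> pverts T). h x) = (\<Sum>x\<in>{1..k} \<times> pverts T. h (Inr x))"
    by (simp add: sum.reindex)
  also have "\<dots> = (\<Sum>a\<in>{1..k}. \<Sum>u\<in>pverts T. h (Inr (a, u)))"
    by (simp add: sum.cartesian_product case_prod_unfold)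
  finally show ?thesis .
qed

lemma center_in_S [simp]: "Inl 0 \<in> pverts S"
  by (simp add: pverts_S)

lemma copy_in_S [simp]: "Inr (a, u) \<in> pverts S \<longleftrightarrow> a \<in> {1..k} \<and> u \<in> pverts T"
  by (auto simp: pverts_S)

lemma weight_S: "weight S x = (\<Sum>y\<in>pverts S. gdist S x y)" if "x \<in> pverts S"
  unfolding weight_def using that by (intro sum.cong S.gdist_sym) auto

text \<open>Moving from the center into a copy gets closer to at most the vertices of that copy, but
  farther from those of another one.\<close>

lemma weight_center_less:
  assumes a: "a \<in> {1..k}" and u: "u \<in> pverts T"
  shows "weight S (Inl 0) < weight S (Inr (a, u))"
proof -
  \<comment> \<open>\<open>c\<close> is the sum of distances from the center to one copy;
    \<open>m\<close> is the increase of that sum when every distance grows by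
    \<open>L u + 1\<close>.\<close>
  define c where "c = (\<Sum>v\<in>pverts T. int (L v) + 1)"
  define m where "m = int (card (pverts T)) * (int (L u) + 1)"
  have "int (weight S (Inl 0)) = int k * c"
    by (simp add: weight_S sum_S gdist_center c_def add.commute)
  also have "\<dots> \<le> int k * c + (int k - 2) * m"
    using k by (simp add: m_def)
  \<comment> \<open>\<open>k - 2\<close> is split into +1 for each of the \<open>k - 1\<close> other
    copies and -1 for copy \<open>a\<close>; the factor \<open>1 - 2 * (...)\<close> is this
    sign.\<close>
  also have "\<dots> = (\<Sum>b\<in>{1..k}. c + (1 - 2 * (if b = a then 1 else 0)) * m)"
    using a by (simp add: sum.distrib sum_subtractf algebra_simps sum_distrib_left[symmetric]
        flip: sum_distrib_right)
  also have "\<dots> \<le> (\<Sum>b\<in>{1..k}. \<Sum>v\<in>pverts T. int (gdist S (Inr (a, u)) (Inr (b, v))))"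
  proof (rule sum_mono)
    fix b
    assume b: "b \<in> {1..k}"
    have "c + (1 - 2 * (if b = a then 1 else 0)) * m =
        (\<Sum>v\<in>pverts T. int (L v) + 1 + (1 - 2 * (if b = a then 1 else 0)) * (int (L u) + 1))"
      by (cases "b = a") (simp_all add: c_def m_def sum.distrib sum_subtractf algebra_simps)
    also have "\<dots> \<le> (\<Sum>v\<in>pverts T. int (gdist S (Inr (a, u)) (Inr (b, v))))"
    proof (rule sum_mono)
      fix v
      assume v: "v \<in> pverts T"
      have "L v \<le> gdist T u v + L u"
        using T.gdist_triangle[OF v w u] T.gdist_sym[OF u v] by simp
      then show "int (L v) + 1 + (1 - 2 * (if b = a then 1 else 0)) * (int (L u) + 1) \<le>
          int (gdist S (Inr (a, u)) (Inr (b, v)))"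
        using a b u v by (auto simp: gdist_copy)
    qed
    finally show "c + (1 - 2 * (if b = a then 1 else 0)) * m \<le>
      (\<Sum>v\<in>pverts T. int (gdist S (Inr (a, u)) (Inr (b, v))))" .
  qed
  \<comment> \<open>The strict excess is the distance \<open>L u + 1\<close> to the center
    itself.\<close>
  also have "\<dots> < int (weight S (Inr (a, u)))"
    using a u by (simp add: weight_S sum_S gdist_copy)
  finally show ?thesis
    by simp
qed

lemma weight_centers_S: "weight_centers S = {Inl 0}"
proof -
  have "weight S (Inl 0) \<le> weight S x" if "x \<in> pverts S" for x
    using that weight_center_less by (cases rule: vertex_cases) (auto intro: less_imp_le)
  moreover have "\<not> weight S x \<le> weight S (Inl 0)" if "x \<in> pverts S" "x \<noteq> Inl 0" for x
    using that(1)
  proof (cases rule: vertex_cases)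
    case (copy a u)
    then show ?thesis
      using weight_center_less[of a u] by simp
  qed (use that in simp)
  ultimately show ?thesis
    using center_in_S unfolding weight_centers_def by blast
qed

lemma card_S: "card (pverts S) = k * card (pverts T) + 1"
proof -
  have "card (Inr ` ({1..k} \<times> pverts T) :: (nat + nat \<times> 'a) set) = k * card (pverts T)"
    by (simp add: card_image card_cartesian_product)
  moreover have "finite (Inr ` ({1..k} \<times> pverts T) :: (nat + nat \<times> 'a) set)"
    using T.pair_finite_verts by simp
  ultimately show ?thesis
    unfolding pverts_S by (subst card_insert_disjoint) auto
qed

text \<open>Also used with \<open>u = v\<close>: then \<open>2 * L u <= gdiam S - 2\<close>, which
  keeps the gaps between copies of one vertex positive in \<open>radio_labeling_S\<close>.\<close>

lemma levels_le_gdiam_S: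
  assumes "u \<in> pverts T" "v \<in> pverts T"
  shows "L u + L v + 2 \<le> gdiam S"
  using S.gdist_le_gdiam[of "Inr (1, u)" "Inr (2, v)"] assms k by (simp add: gdist_copy)

lemma gdiam_le_gdiam_S: "gdiam T + 2 \<le> gdiam S"
proof -
  obtain u v where uv: "u \<in> pverts T" "v \<in> pverts T" "gdist T u v = gdiam T"
    by (rule T.gdiam_attained)
  then have "gdiam T \<le> L u + L v"
    using T.gdist_triangle[OF uv(1,2) w] T.gdist_sym[OF w uv(2)] by simp
  then show ?thesis
    using levels_le_gdiam_S[OF uv(1,2)] by simp
qed

text \<open>Each vertex of a copy lies one level deeper than in \<open>T\<close>; doubled, this
  turns the factor \<open>gdiam S + 1\<close> into \<open>gdiam S - 1\<close>.\<close>

lemma lb_S: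
  "lb S = int k * (int (card (pverts T)) * (int (gdiam S) - 1) - 2 * (\<Sum>u\<in>pverts T. int (L u))) + 1"
proof -
  have "(\<Sum>x\<in>pverts S. int (gdist S x (Inl 0))) = (\<Sum>x\<in>pverts S. int (center_dist x))"
    using S.gdist_sym gdist_center by (intro sum.cong) auto
  also have "\<dots> = int k * ((\<Sum>u\<in>pverts T. int (L u)) + int (card (pverts T)))"
    by (simp add: sum_S sum.distrib add.commute)
  finally show ?thesis
    by (simp add: S.lb_unique_center[OF weight_centers_S] card_S algebra_simps)
qed

section \<open>A labeling of the attached tree\<close>

text \<open>Taking one vertex at a time in the order given by \<open>g\<close>, all its copies are labelled before the
  next vertex is treated. Consecutive vertices then lie in different copies and are labelled as
  tightly as their levels allow; solving the recursion gives the formula below.\<close>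

lemma radio_labeling_S:
  fixes g :: "'a \<Rightarrow> int"
  defines "E \<equiv> int (gdiam S) - 2"
  assumes k3: "3 \<le> k" and u0: "u0 \<in> pverts T" "L u0 = 1" "g u0 = 0"
    and nonneg: "\<And>u. 0 \<le> g u" and le_w: "\<And>u. u \<in> pverts T \<Longrightarrow> g u \<le> g w"
    and gap: "\<And>u v. u \<in> pverts T \<Longrightarrow> v \<in> pverts T \<Longrightarrow> u \<noteq> v \<Longrightarrow>
      E + 1 - int (gdist T u v) \<le> \<bar>g u - g v\<bar>"
  shows "int (rn S) \<le> int k * (g w + E) + 1"
proof -
  define l where "l u = int (L u)" for u
  \<comment> \<open>The center gets 0 and the first copy of \<open>u0\<close> gets
    \<open>E + 1\<close>. Consecutive copies of \<open>u\<close> differ by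
    \<open>E + 1 - 2 * l u\<close>, and the first copy of \<open>v\<close> exceeds the last copy of
    \<open>u\<close> by \<open>k * (g v - g u) - (k - 1) * (E + 1 - l u - l v)\<close>. With levels
    \<open>l u + 1\<close> and diameter \<open>E + 2\<close>, this is the tight gap whenever
    \<open>g v - g u = E + 1 - l u - l v\<close>.\<close>
  define F where "F x = (case x of Inl _ \<Rightarrow> 0 | Inr (a, u) \<Rightarrow>
    int k * g u + int a * (E + 3) + int k * (l u - 1) - (2 * int a - 1) * (l u + 1))"
    for x :: "nat + nat \<times> 'a"
  have l_nonneg: "0 \<le> l u" for u
    by (simp add: l_def)
  have l_le: "2 * l u \<le> E" if "u \<in> pverts T" for u
    using levels_le_gdiam_S[OF that that] by (simp add: l_def E_def)
  have gdist_le: "int (gdist T u v) \<le> l u + l v" if "u \<in> pverts T" "v \<in> pverts T" for u v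
    using T.gdist_triangle[OF that w] T.gdist_sym[OF w that(2)] by (simp add: l_def)
  have gap_levels: "E + 1 - l u - l v \<le> \<bar>g u - g v\<bar>"
    if "u \<in> pverts T" "v \<in> pverts T" "u \<noteq> v" for u v
    using gap[OF that] gdist_le[OF that(1,2)] by linarith
  have F_center: "E + 2 - l u \<le> F (Inr (a, u))" if a: "a \<in> {1..k}" and u: "u \<in> pverts T" for a u
  proof -
    \<comment> \<open>\<open>slack\<close> is about \<open>F (Inr (a, u)) - F (Inr (1, u))\<close>,
      so the first copy decides; there \<open>u0\<close> attains the bound.\<close>
    have slack: "0 \<le> (int a - 1) * (E + 1 - 2 * l u)"
      using a l_le[OF u] by (intro mult_nonneg_nonneg) auto
    show ?thesis
    proof (cases "u = u0")
      case True
      then show ?thesis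
        using slack u0 by (simp add: F_def l_def algebra_simps)
    next
      case False
      have "2 \<le> E"
        using l_le[OF u0(1)] u0 by (simp add: l_def)
      have "l u0 = 1"
        using u0 by (simp add: l_def)
      then have "E - l u \<le> g u"
        using gap_levels[OF u u0(1) False] nonneg[of u] u0 by simp
      then have "0 \<le> int k * (g u - (E - l u))"
        by simp
      moreover have "0 \<le> (int k - 1) * (E - 1)"
        using k3 \<open>2 \<le> E\<close> by (intro mult_nonneg_nonneg) auto
      ultimately show ?thesis
        using slack \<open>2 \<le> E\<close> l_nonneg[of u] by (simp add: F_def algebra_simps)
    qed
  qed
  have cross: "E + 1 - l u - l v \<le> F (Inr (b, v)) - F (Inr (a, u))"
    if ab: "a \<in> {1..k}" "b \<in> {1..k}" and uv: "u \<in> pverts T" "v \<in> pverts T"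
      and less: "u \<noteq> v" "g u \<le> g v" for a b u v
  proof -
    have "E + 1 - l u - l v \<le> g v - g u"
      using gap_levels[OF uv less(1)] less(2) by linarith
    then have "0 \<le> int k * (g v - g u - (E + 1 - l u - l v))"
      by simp
    \<comment> \<open>These two terms are the label differences from copy \<open>a\<close> of
      \<open>u\<close> to its last copy and from the first copy of \<open>v\<close> to copy
      \<open>b\<close>.\<close>
    moreover have "0 \<le> (int k - int a) * (E + 1 - 2 * l u)"
      using ab l_le[OF uv(1)] by (intro mult_nonneg_nonneg) auto
    moreover have "0 \<le> (int b - 1) * (E + 1 - 2 * l v)"
      using ab l_le[OF uv(2)] by (intro mult_nonneg_nonneg) auto
    ultimately show ?thesis
      by (simp add: F_def algebra_simps)
  qed
  have same: "E + 3 - int (gdist T u v) \<le> F (Inr (a, v)) - F (Inr (a, u))"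
    if a: "a \<in> {1..k}" and uv: "u \<in> pverts T" "v \<in> pverts T" and less: "u \<noteq> v" "g u \<le> g v"
    for a u v
  proof -
    have "E + 1 - int (gdist T u v) \<le> g v - g u"
      using gap[OF uv less(1)] less(2) by linarith
    moreover have "E + 1 - l u - l v \<le> g v - g u"
      using gap_levels[OF uv less(1)] less(2) by linarith
    then have "0 \<le> (int k - 1) * (g v - g u - (E + 1 - l u - l v))"
      using k3 by (intro mult_nonneg_nonneg) auto
    \<comment> \<open>Inside one copy the condition demands 2 more than the gap of \<open>g\<close>
      guarantees. The \<open>k - a\<close> steps through later copies of \<open>u\<close> and the
      \<open>a - 1\<close> steps through earlier copies of \<open>v\<close> add at least 1 each, in
      total \<open>k - 1 >= 2\<close>.\<close>
    moreover have "(int k - int a) * 1 \<le> (int k - int a) * (E + 1 - 2 * l u)"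
      using a l_le[OF uv(1)] by (intro mult_left_mono) auto
    moreover have "(int a - 1) * 1 \<le> (int a - 1) * (E + 1 - 2 * l v)"
      using a l_le[OF uv(2)] by (intro mult_left_mono) auto
    ultimately show ?thesis
      using k3 by (simp add: F_def algebra_simps)
  qed
  have twins: "E + 1 - l u - l u \<le> F (Inr (b, u)) - F (Inr (a, u))"
    if ab: "a < b" and u: "u \<in> pverts T" for a b u
  proof -
    have "1 * (E + 1 - 2 * l u) \<le> (int b - int a) * (E + 1 - 2 * l u)"
      using ab l_le[OF u] by (intro mult_right_mono) auto
    then show ?thesis
      by (simp add: F_def algebra_simps)
  qed
  have F_nonneg: "0 \<le> F x" if "x \<in> pverts S" for x
    using that
  proof (cases rule: vertex_cases)
    case (copy a u)
    then show ?thesis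
      using F_center[of a u] l_le[of u] l_nonneg[of u] by simp
  qed (simp add: F_def)
  have labels: "E + 3 - int (gdist S x y) \<le> \<bar>F x - F y\<bar>"
    if xy: "x \<in> pverts S" "y \<in> pverts S" "x \<noteq> y" for x y
  proof -
    have from_center: "E + 3 - int (gdist S (Inl 0) y) \<le> \<bar>F (Inl 0) - F y\<bar>"
      if y: "y \<in> pverts S" "y \<noteq> Inl 0" for y
      using y(1)
    proof (cases rule: vertex_cases)
      case (copy a u)
      have "F (Inl 0) = 0"
        by (simp add: F_def)
      moreover have "int (gdist S (Inl 0) y) = l u + 1"
        using gdist_center[OF y(1)] copy by (simp add: l_def)
      ultimately show ?thesis
        using F_center[OF copy(2,3)] copy(1) by simp
    qed (use y in simp)
    have copies: "E + 3 - int (gdist S (Inr (a, u)) (Inr (b, v))) \<le> \<bar>F (Inr (a, u)) - F (Inr (b, v))\<bar>"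
      if *: "a \<in> {1..k}" "b \<in> {1..k}" "u \<in> pverts T" "v \<in> pverts T"
        and less: "u \<noteq> v \<and> g u \<le> g v \<or> u = v \<and> a < b" for a b u v
    proof (cases "a = b")
      case True
      then show ?thesis
        using same[of b u v] less * by (simp add: gdist_copy)
    next
      case False
      then have "int (gdist S (Inr (a, u)) (Inr (b, v))) = l u + l v + 2"
        using * by (simp add: gdist_copy l_def)
      moreover have "E + 1 - l u - l v \<le> F (Inr (b, v)) - F (Inr (a, u))"
        using cross[of a b u v] twins[of a b u] less * by auto
      ultimately show ?thesis
        by linarith
    qed
    show ?thesis
      using xy(1)
    proof (cases rule: vertex_cases)
      case center
      then show ?thesis
        using from_center[of y] xy by simp
    next
      case x: (copy a u)
      show ?thesis
        using xy(2)
      proof (cases rule: vertex_cases)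
        case center
        then show ?thesis
          using from_center[of x] xy S.gdist_sym[OF xy(1,2)]
          by (simp add: abs_minus_commute)
      next
        case y: (copy b v)
        consider "u \<noteq> v \<and> g u \<le> g v \<or> u = v \<and> a < b" | "v \<noteq> u \<and> g v \<le> g u \<or> v = u \<and> b < a"
          using xy(3) x y by fastforce
        then show ?thesis
        proof cases
          case 1
          then show ?thesis
            using copies[of a b u v] x y by simp
        next
          case 2
          then show ?thesis
            using copies[of b a v u] x y S.gdist_sym[OF xy(1,2)] by (simp add: abs_minus_commute)
        qed
      qed
    qed
  qed
  have "radio_labeling S (\<lambda>x. nat (F x))"
    unfolding radio_labeling_def
  proof (intro ballI impI)
    fix x y
    assume xy: "x \<in> pverts S" "y \<in> pverts S" "x \<noteq> y"
    then show "int (gdiam S) + 1 - int (gdist S x y) \<le> \<bar>int (nat (F x)) - int (nat (F y))\<bar>"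
      using labels[OF xy] F_nonneg by (simp add: E_def)
  qed
  moreover have "F x \<le> int k * (g w + E) + 1" if "x \<in> pverts S" for x
  proof -
    have l_w: "l w = 0"
      using w by (simp add: l_def)
    \<comment> \<open>The largest label sits at the last copy of \<open>w\<close>, because
      \<open>g\<close> is maximal at \<open>w\<close>.\<close>
    then have last: "F (Inr (k, w)) = int k * (g w + E) + 1"
      by (simp add: F_def algebra_simps)
    show ?thesis
      using that
    proof (cases rule: vertex_cases)
      case center
      then show ?thesis
        using F_nonneg[of "Inr (k, w)"] last k w by (simp add: F_def)
    next
      case (copy a u)
      have "F (Inr (a, u)) \<le> F (Inr (k, w))"
      proof (cases "u = w")
        case True
        then show ?thesis
          using twins[of a k w] w l_w l_le[OF w] copy by (cases "a = k") auto
      next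
        case False
        then show ?thesis
          using cross[of a k u w] le_w[of u] l_w l_le[of u] l_nonneg[of u] copy w k by simp
      qed
      then show ?thesis
        using last copy by simp
    qed
  qed
  then have "nat (F x) \<le> nat (int k * (g w + E) + 1)" if "x \<in> pverts S" for x
    using that by (intro nat_mono)
  ultimately have "rn S \<le> nat (int k * (g w + E) + 1)"
    by (intro S.rn_le)
  moreover have "0 \<le> int k * (g w + E) + 1"
    using nonneg[of w] l_le[OF w] l_nonneg[of w] by simp
  ultimately show ?thesis
    by linarith
qed

end

section \<open>The radio number of the attached tree\<close>

theorem theorem3p3:
  fixes T :: "'a pair_pre_digraph" and w0 :: 'a and n0 d0 k d :: nat
  assumes "T \<in> lower_bound_trees"
    and "n0 = card (pverts T)" and "d0 = gdiam T"
    and "weight_centers T = {w0}"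
    and "k \<ge> 3"
    and "d = gdiam (leaf_attach T w0 (star k))"
  shows "leaf_attach T w0 (star k) \<in> lower_bound_trees \<and>
    int (rn (leaf_attach T w0 (star k))) =
      int k * (int (rn T) + int n0 * (int d - int d0 - 2) + int d0) + 1"
proof -
  have T: "simple_tree T" "2 \<le> gdiam T" "int (rn T) = lb T"
    using assms(1) by (auto simp: lower_bound_trees_def)
  interpret T: connected_graph T
    using T(1) by (simp add: simple_tree_def connected_graph_def connected_graph_axioms_def)
  interpret star_attachment T w0 k
    by unfold_locales (use assms in \<open>auto simp: weight_centers_def\<close>)
  have diam: "gdiam T + 2 \<le> gdiam S"
    by (rule gdiam_le_gdiam_S)
  have tree: "simple_tree S"
    using T(1) acyclic_S pair_graph_S connected_S by (simp add: simple_tree_def)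
  \<comment> \<open>Each vertex sits one level deeper in \<open>S\<close>, so the gap bound of
    \<open>S\<close>, written with levels of \<open>T\<close>, is the one that \<open>T\<close>
    would have for diameter \<open>gdiam S - 2\<close>.\<close>
  define E where "E = int (gdiam S) - 2"
  obtain f u where f: "radio_labeling T f" "u \<in> pverts T" "f u = 0" "L u = 1" "f w0 = rn T"
    "\<And>x. x \<in> pverts T \<Longrightarrow> f x \<le> rn T"
    using T.optimal_labelingE[OF assms(4) T(3)] T(2) by auto
  have "int (gdiam T) \<le> E"
    using diam by (simp add: E_def)
  then obtain g where g: "g u = 0" "\<And>x. 0 \<le> g x" "\<And>x. x \<in> pverts T \<Longrightarrow> g x \<le> g w0"
    "g w0 = int (rn T) + (int n0 - 1) * (E - int d0)"
    "\<And>x y. x \<in> pverts T \<Longrightarrow> y \<in> pverts T \<Longrightarrow> x \<noteq> y \<Longrightarrow> E + 1 - int (gdist T x y) \<le> \<bar>g x - g y\<bar>"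
    using T.stretched_labelingE[OF f(1) _ f(2,3) w, of E] f(5,6) assms(2,3) by metis
  define s where "s = int k * (int (rn T) + int n0 * (int d - int d0 - 2) + int d0) + 1"
  have "int (rn S) \<le> int k * (g w0 + E) + 1"
    unfolding E_def by (rule radio_labeling_S) (use f g assms(5) in \<open>auto simp: E_def\<close>)
  \<comment> \<open>Uses \<open>(n0 - 1) * (E - d0) + E = n0 * (E - d0) + d0\<close>.\<close>
  also have "\<dots> = s"
    by (simp add: s_def g(4) E_def assms(6) algebra_simps)
  finally have "int (rn S) \<le> s" .
  \<comment> \<open>Eliminating the sum of levels through \<open>rn T = lb T\<close> makes the lower
    bound meet the constructed upper bound.\<close>
  moreover have "lb S = s"
    by (simp add: s_def lb_S T(3) T.lb_unique_center[OF assms(4)] assms algebra_simps)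
  moreover have "lb S \<le> int (rn S)"
    using S.lb_le_rn[OF weight_centers_S] diam by simp
  ultimately show ?thesis
    using tree diam unfolding lower_bound_trees_def s_def by simp
qed

end
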